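(* Let $T=(V,E)$ be a finite tree with a distinguished node $v^\ast$, and let $\mathcal{M}\in\{\mathcal{MIN},\mathcal{MAJ}\}$. Then there exists a bijection between $E_{fix}(T)$ and $\mathcal{F}_{\mathcal{M}}(T)^+$.
   Context: A coloring of $T$ is a map $c:V\to\{0,1\}$. For a node $v$ and $i\in\{0,1\}$, $N^i(v)$ denotes the set of neighbors of $v$ with color $i$. The minority process maps $c$ to $\mathcal{MIN}(c)$ with $\mathcal{MIN}(c)(v)=c(v)$ if $|N^{c(v)}(v)|\le|N^{1-c(v)}(v)|$ and $\mathcal{MIN}(c)(v)=1-c(v)$ otherwise. The majority process $\mathcal{MAJ}$ is defined by $\mathcal{MAJ}(c)(v)=c(v)$ if $|N^{c(v)}(v)|\ge|N^{1-c(v)}(v)|$ and $1-c(v)$ otherwise (all nodes update simultaneously). A coloring $c$ is a fixed point of $\mathcal{M}$ if $\mathcal{M}(c)=c$; $\mathcal{F}_{\mathcal{M}}(T)$ is the set of fixed points and $\mathcal{F}_{\mathcal{M}}(T)^+$ the set of fixed points $c$ with $c(v^\ast)=0$. $E^2(T)$ is the set of edges of $T$ both of whose end nodes have degree at least $2$. For $F\subseteq E$ and a node $v$, $F_v$ denotes the number of edges of $F$ incident to $v$. A set $F\subseteq E^2(T)$ is legal if $F_v\le \deg(v)/2$ for every node $v$; $E_{fix}(T)$ is the set of all legal subsets of $E^2(T)$. *)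

theory Defs
  imports Complex_Main "HOL-Library.FuncSet"
begin

text \<open>An undirected edge is a two-element set of nodes.\<close>

definition fin_graph :: "'a set \<Rightarrow> 'a set set \<Rightarrow> bool" where
  "fin_graph V E \<longleftrightarrow> finite V \<and> (\<forall>e\<in>E. e \<subseteq> V \<and> card e = 2)"

definition connected_graph :: "'a set \<Rightarrow> 'a set set \<Rightarrow> bool" where
  "connected_graph V E \<longleftrightarrow> V \<noteq> {} \<and> (\<forall>u\<in>V. \<forall>v\<in>V. (u, v) \<in> {(x, y). {x, y} \<in> E}\<^sup>*)"

text \<open>A cycle is the list of its nodes, without repetition of the start node at the end.\<close>

definition is_cycle :: "'a set set \<Rightarrow> 'a list \<Rightarrow> bool" where
  "is_cycle E xs \<longleftrightarrow> length xs \<ge> 3 \<and> distinct xs \<and>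
     (\<forall>i. Suc i < length xs \<longrightarrow> {xs ! i, xs ! Suc i} \<in> E) \<and> {last xs, hd xs} \<in> E"

definition fin_tree :: "'a set \<Rightarrow> 'a set set \<Rightarrow> bool" where
  "fin_tree V E \<longleftrightarrow> fin_graph V E \<and> connected_graph V E \<and> (\<nexists>xs. is_cycle E xs)"

text \<open>\<open>deg F v\<close> is the degree of \<open>v\<close> when \<open>F\<close> is the full edge set of the graph, and \<open>F\<^sub>v\<close>
  for a set \<open>F\<close> of some of the edges.\<close>

definition deg :: "'a set set \<Rightarrow> 'a \<Rightarrow> nat" where
  "deg F v = card {e \<in> F. v \<in> e}"

text \<open>Colorings are extensional (\<open>undefined\<close> outside \<open>V\<close>), so that they correspond
  one-to-one to maps from \<open>V\<close> to \<open>{0, 1}\<close>.\<close>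

definition colorings :: "'a set \<Rightarrow> ('a \<Rightarrow> nat) set" where
  "colorings V = V \<rightarrow>\<^sub>E {0, 1}"

definition nbrs :: "'a set set \<Rightarrow> ('a \<Rightarrow> nat) \<Rightarrow> nat \<Rightarrow> 'a \<Rightarrow> 'a set" where
  "nbrs E c i v = {u. {u, v} \<in> E \<and> c u = i}"

definition min_proc :: "'a set \<Rightarrow> 'a set set \<Rightarrow> ('a \<Rightarrow> nat) \<Rightarrow> 'a \<Rightarrow> nat" where
  "min_proc V E c = (\<lambda>v\<in>V. if card (nbrs E c (c v) v) \<le> card (nbrs E c (1 - c v) v)
       then c v else 1 - c v)"

definition maj_proc :: "'a set \<Rightarrow> 'a set set \<Rightarrow> ('a \<Rightarrow> nat) \<Rightarrow> 'a \<Rightarrow> nat" where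
  "maj_proc V E c = (\<lambda>v\<in>V. if card (nbrs E c (c v) v) \<ge> card (nbrs E c (1 - c v) v)
       then c v else 1 - c v)"

definition fixed_points :: "'a set \<Rightarrow> (('a \<Rightarrow> nat) \<Rightarrow> 'a \<Rightarrow> nat) \<Rightarrow> ('a \<Rightarrow> nat) set" where
  "fixed_points V M = {c \<in> colorings V. M c = c}"

definition fixed_points_plus ::
  "'a set \<Rightarrow> (('a \<Rightarrow> nat) \<Rightarrow> 'a \<Rightarrow> nat) \<Rightarrow> 'a \<Rightarrow> ('a \<Rightarrow> nat) set" where
  "fixed_points_plus V M r = {c \<in> fixed_points V M. c r = 0}"

definition E2 :: "'a set set \<Rightarrow> 'a set set" where
  "E2 E = {e \<in> E. \<forall>v\<in>e. deg E v \<ge> 2}"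

definition legal :: "'a set \<Rightarrow> 'a set set \<Rightarrow> 'a set set \<Rightarrow> bool" where
  "legal V E F \<longleftrightarrow> F \<subseteq> E2 E \<and> (\<forall>v\<in>V. real (deg F v) \<le> real (deg E v) / 2)"

definition E_fix :: "'a set \<Rightarrow> 'a set set \<Rightarrow> 'a set set set" where
  "E_fix V E = {F. legal V E F}"

end

theory Submission
  imports Defs
begin

text \<open>A coloring with \<open>c v\<^sup>* = 0\<close> is sent to the set of its monochromatic edges (minority process)
  or of its bichromatic edges (majority process). On a tree every edge set arises in this way from
  exactly one coloring: connectedness gives uniqueness, and existence follows by adding the edges
  one at a time, flipping all colors in one of the two components that the new edge joins if
  necessary. Being a fixed point says that at every node at most half of the incident edges lie in
  the associated set; at a leaf this means that the set avoids the incident edge, so the restriction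
  to \<open>E\<^sup>2(T)\<close> is automatic.\<close>

text \<open>Counting the colors on an edge treats both processes with one parameter:
  \<open>k = 1\<close> gives the monochromatic edges, \<open>k = 2\<close> the bichromatic
  ones.\<close>

definition edge_class :: "'a set set \<Rightarrow> ('a \<Rightarrow> nat) \<Rightarrow> nat \<Rightarrow> 'a set set" where
  "edge_class E c k = {e \<in> E. card (c ` e) = k}"

lemma card_image_edge: "card (c ` {u, v}) = (if c u = c v then 1 else 2)"
  by auto

lemma edge_at_node:
  assumes "\<forall>e\<in>E. card e = 2" "e \<in> E" "v \<in> e"
  shows "\<exists>u. e = {u, v}"
proof -
  obtain x y where "e = {x, y}" using assms(1,2) by (meson card_2_iff)
  then show ?thesis using assms(3) by auto
qed

section \<open>Paths, cycles and cuts\<close>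

text \<open>A step back to a node already on the path is handled by truncating the path there.
  Distinctness is what \<open>is_cycle\<close> asks for.\<close>

lemma rtrancl_imp_distinct_path:
  assumes "(x, y) \<in> {(x, y). R x y}\<^sup>*"
  shows "\<exists>xs. xs \<noteq> [] \<and> distinct xs \<and> hd xs = x \<and> last xs = y \<and> successively R xs"
  using assms
proof (induction rule: rtrancl_induct)
  case base
  show ?case by (rule exI[of _ "[x]"]) simp
next
  case (step y z)
  then obtain xs where xs: "xs \<noteq> []" "distinct xs" "hd xs = x" "last xs = y" "successively R xs"
    by blast
  show ?case
  proof (cases "z \<in> set xs")
    case True
    then obtain ys zs where "xs = ys @ z # zs" by (meson split_list)
    then show ?thesis using xs
      by (intro exI[of _ "ys @ [z]"])
        (auto simp: hd_append successively_append_iff split: if_splits)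
  next
    case False
    then show ?thesis using xs step.hyps
      by (intro exI[of _ "xs @ [z]"]) (auto simp: successively_append_iff)
  qed
qed

text \<open>The edge \<open>{a, b}\<close> would close a repetition-free path from \<open>b\<close>
  to \<open>a\<close> in \<open>E\<close> into a cycle.\<close>

lemma acyclic_edge_disconnects:
  assumes "\<nexists>xs. is_cycle (insert {a, b} E) xs" "{a, b} \<notin> E" "a \<noteq> b"
  shows "(b, a) \<notin> {(x, y). {x, y} \<in> E}\<^sup>*"
proof
  assume "(b, a) \<in> {(x, y). {x, y} \<in> E}\<^sup>*"
  then obtain xs where xs: "xs \<noteq> []" "distinct xs" "hd xs = b" "last xs = a"
    "successively (\<lambda>x y. {x, y} \<in> E) xs"
    using rtrancl_imp_distinct_path[of b a "\<lambda>x y. {x, y} \<in> E"] by blast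
  \<comment> \<open>A single node would force \<open>a = b\<close>, and two nodes would put
    \<open>{a, b}\<close> into \<open>E\<close>.\<close>
  have "length xs \<ge> 3"
  proof (rule ccontr)
    assume "\<not> length xs \<ge> 3"
    then have "length xs = Suc 0 \<or> length xs = Suc (Suc 0)"
      using length_greater_0_conv[of xs] xs(1) by linarith
    then show False
      using xs assms by (auto simp: length_Suc_conv insert_commute)
  qed
  then have "is_cycle (insert {a, b} E) xs"
    using xs by (auto simp: is_cycle_def successively_conv_nth)
  then show False using assms(1) by blast
qed

lemma is_cycle_mono: "is_cycle E xs \<Longrightarrow> E \<subseteq> E' \<Longrightarrow> is_cycle E' xs"
  by (auto simp: is_cycle_def)

text \<open>Existence half of the correspondence, with \<open>P\<close> as a two-coloring and
  \<open>F\<close> as its set of bichromatic edges.\<close>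

lemma acyclic_edge_set_is_cut:
  fixes E :: "'a set set"
  assumes "finite E" "\<forall>e\<in>E. card e = 2" "\<nexists>xs. is_cycle E xs" "F \<subseteq> E"
  shows "\<exists>P :: 'a \<Rightarrow> bool. \<forall>u v. {u, v} \<in> E \<longrightarrow> ({u, v} \<in> F \<longleftrightarrow> P u \<noteq> P v)"
  using assms
proof (induction E arbitrary: F)
  case empty
  show ?case by simp
next
  case (insert e E)
  obtain a b where e: "e = {a, b}" "a \<noteq> b"
    using insert.prems(1) by (auto simp: card_2_iff)
  have acyclic: "\<nexists>xs. is_cycle E xs"
    using insert.prems(2) is_cycle_mono[OF _ subset_insertI] by blast
  have "\<forall>e\<in>E. card e = 2" "F - {e} \<subseteq> E" using insert.prems(1,3) by auto
  then obtain P :: "'a \<Rightarrow> bool"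
    where P: "\<forall>u v. {u, v} \<in> E \<longrightarrow> ({u, v} \<in> F - {e} \<longleftrightarrow> P u \<noteq> P v)"
    by (rule exE[OF insert.IH[OF _ acyclic]])
  \<comment> \<open>The component of \<open>b\<close> before \<open>e\<close> is added. No edge of
    \<open>E\<close> leaves it, and \<open>a\<close> lies outside, so flipping \<open>P\<close> on
    it affects \<open>e\<close> alone.\<close>
  let ?B = "{x. (b, x) \<in> {(x, y). {x, y} \<in> E}\<^sup>*}"
  have B: "b \<in> ?B" "a \<notin> ?B"
    using acyclic_edge_disconnects[of a b E] insert.prems(2) insert.hyps e by auto
  have closed: "u \<in> ?B \<longleftrightarrow> v \<in> ?B" if "{u, v} \<in> E" for u v
  proof -
    have "(u, v) \<in> {(x, y). {x, y} \<in> E}" "(v, u) \<in> {(x, y). {x, y} \<in> E}"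
      using that by (auto simp: insert_commute)
    then show ?thesis by (blast intro: rtrancl_into_rtrancl)
  qed
  \<comment> \<open>\<open>s\<close> says that \<open>P\<close> is wrong on the new edge, so that
    the flip in \<open>Q\<close> is called for.\<close>
  define s where "s \<longleftrightarrow> (e \<in> F) \<noteq> (P a \<noteq> P b)"
  define Q where "Q x \<longleftrightarrow> P x \<noteq> (s \<and> x \<in> ?B)" for x
  have "{u, v} \<in> F \<longleftrightarrow> Q u \<noteq> Q v" if "{u, v} \<in> insert e E" for u v
  proof (cases "{u, v} = e")
    case True
    then have "u = a \<and> v = b \<or> u = b \<and> v = a" by (auto simp: e doubleton_eq_iff)
    moreover have "e \<in> F \<longleftrightarrow> Q a \<noteq> Q b" using B by (auto simp: Q_def s_def)
    ultimately show ?thesis using True by auto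
  next
    case False
    then show ?thesis using that P[rule_format, of u v] closed[of u v] by (auto simp: Q_def)
  qed
  then show ?case by blast
qed

section \<open>Colorings of a tree and edge sets\<close>

lemma fin_treeD:
  assumes "fin_tree V E"
  shows "finite V" "finite E" "\<forall>e\<in>E. card e = 2" "\<forall>e\<in>E. e \<subseteq> V"
    "\<nexists>xs. is_cycle E xs" "connected_graph V E"
proof -
  show V: "finite V" "\<forall>e\<in>E. e \<subseteq> V" and "\<forall>e\<in>E. card e = 2"
    and "\<nexists>xs. is_cycle E xs" "connected_graph V E"
    using assms by (simp_all add: fin_tree_def fin_graph_def)
  have "E \<subseteq> Pow V" using V(2) by blast
  then show "finite E" using V(1) by (simp add: finite_subset)
qed

lemma coloring_eq_or:
  "c \<in> colorings V \<Longrightarrow> v \<in> V \<Longrightarrow> c v = 0 \<or> c v = 1"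
  by (auto simp: colorings_def PiE_def Pi_def)

text \<open>For either \<open>k\<close>, the class tells whether the ends of an edge agree. With two
  colors, one end then determines the other, and the values spread from \<open>r\<close> along
  paths.\<close>

lemma coloring_determined_by_edge_class:
  assumes conn: "connected_graph V E" and sub: "\<forall>e\<in>E. e \<subseteq> V" and "r \<in> V" "k \<in> {1, 2}"
    and c: "c \<in> colorings V" and d: "d \<in> colorings V" and "c r = d r"
    and eq: "edge_class E c k = edge_class E d k"
  shows "c = d"
proof (rule PiE_ext)
  show "c \<in> V \<rightarrow>\<^sub>E {0, 1}" "d \<in> V \<rightarrow>\<^sub>E {0, 1}"
    using c d by (simp_all add: colorings_def)
  fix x assume "x \<in> V"
  then have "(r, x) \<in> {(x, y). {x, y} \<in> E}\<^sup>*"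
    using conn \<open>r \<in> V\<close> by (auto simp: connected_graph_def)
  then show "c x = d x"
  proof (induction rule: rtrancl_induct)
    case base
    show ?case by fact
  next
    case (step y z)
    then have E: "{y, z} \<in> E" by simp
    then have "y \<in> V" "z \<in> V" using sub by auto
    have "card (c ` {y, z}) = k \<longleftrightarrow> card (d ` {y, z}) = k"
      using eq E unfolding edge_class_def by blast
    then have "c y = c z \<longleftrightarrow> d y = d z"
      using \<open>k \<in> {1, 2}\<close> unfolding card_image_edge by (auto split: if_splits)
    then show ?case
      using step.IH coloring_eq_or[OF c \<open>y \<in> V\<close>] coloring_eq_or[OF c \<open>z \<in> V\<close>]
        coloring_eq_or[OF d \<open>y \<in> V\<close>] coloring_eq_or[OF d \<open>z \<in> V\<close>] by auto
  qed
qed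

lemma bij_betw_edge_class:
  assumes tree: "fin_tree V E" and "r \<in> V" and k: "k \<in> {1, 2}"
  shows "bij_betw (\<lambda>c. edge_class E c k) {c \<in> colorings V. c r = 0} (Pow E)"
proof -
  note T = fin_treeD[OF tree]
  have "\<exists>c. c \<in> colorings V \<and> c r = 0 \<and> edge_class E c k = F" if "F \<subseteq> E" for F
  proof -
    \<comment> \<open>\<open>G\<close> is the intended set of bichromatic edges, hence the
      complement of \<open>F\<close> when \<open>k = 1\<close>.\<close>
    define G where "G = (if k = 2 then F else E - F)"
    have "G \<subseteq> E" using \<open>F \<subseteq> E\<close> by (simp add: G_def)
    then obtain P :: "'a \<Rightarrow> bool"
      where P: "\<forall>u v. {u, v} \<in> E \<longrightarrow> ({u, v} \<in> G \<longleftrightarrow> P u \<noteq> P v)"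
      by (rule exE[OF acyclic_edge_set_is_cut[OF T(2,3,5)]])
    \<comment> \<open>Comparing with \<open>P r\<close> normalizes the color of \<open>r\<close> to
      0 without changing the cut.\<close>
    define c :: "'a \<Rightarrow> nat" where "c = (\<lambda>x\<in>V. if P x = P r then 0 else 1)"
    have "card (c ` e) = k \<longleftrightarrow> e \<in> F" if "e \<in> E" for e
    proof -
      obtain u v where e: "e = {u, v}"
        using T(3) \<open>e \<in> E\<close> by (meson card_2_iff)
      have "u \<in> V" "v \<in> V" using T(4) that e by auto
      then have "c u = c v \<longleftrightarrow> P u = P v" by (simp add: c_def)
      then have "c u = c v \<longleftrightarrow> e \<notin> G" using P that e by auto
      then show ?thesis using k that unfolding e card_image_edge
        by (auto simp: G_def split: if_splits)
    qed
    then have "edge_class E c k = F" using \<open>F \<subseteq> E\<close> by (auto simp: edge_class_def)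
    moreover have "c \<in> colorings V" "c r = 0"
      using \<open>r \<in> V\<close> by (auto simp: c_def colorings_def)
    ultimately show ?thesis by blast
  qed
  then have "Pow E \<subseteq> (\<lambda>c. edge_class E c k) ` {c \<in> colorings V. c r = 0}"
    by (auto simp: image_iff)
  moreover have "inj_on (\<lambda>c. edge_class E c k) {c \<in> colorings V. c r = 0}"
    using coloring_determined_by_edge_class[OF T(6,4) \<open>r \<in> V\<close> k] by (auto intro!: inj_onI)
  ultimately show ?thesis by (auto simp: bij_betw_def edge_class_def)
qed

section \<open>Fixed points and legal edge sets\<close>

text \<open>A neighbor \<open>u\<close> of \<open>v\<close> corresponds to the edge
  \<open>{u, v}\<close>, which turns neighbor counts into degrees in the two edge classes.\<close>

lemma card_nbrs:
  assumes two: "\<forall>e\<in>E. card e = 2" and sub: "\<forall>e\<in>E. e \<subseteq> V"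
    and c: "c \<in> colorings V" and "v \<in> V"
  shows "card (nbrs E c (c v) v) = deg (edge_class E c 1) v"
    and "card (nbrs E c (1 - c v) v) = deg (edge_class E c 2) v"
proof -
  \<comment> \<open>An edge at \<open>v\<close> has exactly one other end, so the quantifier over
    \<open>u\<close> just evaluates \<open>Q\<close> there.\<close>
  have bij: "bij_betw (\<lambda>u. {u, v}) {u. {u, v} \<in> E \<and> Q u} {e \<in> E. v \<in> e \<and> (\<forall>u. e = {u, v} \<longrightarrow> Q u)}"
    for Q
  proof (rule bij_betw_imageI)
    show "inj_on (\<lambda>u. {u, v}) {u. {u, v} \<in> E \<and> Q u}"
      by (auto simp: inj_on_def doubleton_eq_iff)
    show "(\<lambda>u. {u, v}) ` {u. {u, v} \<in> E \<and> Q u} = {e \<in> E. v \<in> e \<and> (\<forall>u. e = {u, v} \<longrightarrow> Q u)}"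
      using edge_at_node[OF two] by (fastforce simp: doubleton_eq_iff)
  qed
  have other: "c u = 1 - c v \<longleftrightarrow> c u \<noteq> c v" if "{u, v} \<in> E" for u
    using coloring_eq_or[OF c, of u] coloring_eq_or[OF c \<open>v \<in> V\<close>] sub that by auto
  have mono: "card (c ` e) = 1 \<longleftrightarrow> (\<forall>u. e = {u, v} \<longrightarrow> c u = c v)"
    and bi: "card (c ` e) = 2 \<longleftrightarrow> (\<forall>u. e = {u, v} \<longrightarrow> c u \<noteq> c v)"
    if "e \<in> E" "v \<in> e" for e
  proof -
    obtain u where e: "e = {u, v}"
      using edge_at_node[OF two \<open>e \<in> E\<close> \<open>v \<in> e\<close>] by blast
    then have "e = {w, v} \<longleftrightarrow> w = u" for w by (auto simp: doubleton_eq_iff)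
    then show "card (c ` e) = 1 \<longleftrightarrow> (\<forall>u. e = {u, v} \<longrightarrow> c u = c v)"
      and "card (c ` e) = 2 \<longleftrightarrow> (\<forall>u. e = {u, v} \<longrightarrow> c u \<noteq> c v)"
      using card_image_edge[of c u v] e by simp_all
  qed
  have "{e \<in> edge_class E c 1. v \<in> e} = {e \<in> E. v \<in> e \<and> (\<forall>u. e = {u, v} \<longrightarrow> c u = c v)}"
    unfolding edge_class_def using mono by blast
  then show "card (nbrs E c (c v) v) = deg (edge_class E c 1) v"
    using bij_betw_same_card[OF bij[of "\<lambda>u. c u = c v"]] by (simp add: nbrs_def deg_def)
  have "{e \<in> edge_class E c 2. v \<in> e} = {e \<in> E. v \<in> e \<and> (\<forall>u. e = {u, v} \<longrightarrow> c u \<noteq> c v)}"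
    unfolding edge_class_def using bi by blast
  moreover have "nbrs E c (1 - c v) v = {u. {u, v} \<in> E \<and> c u \<noteq> c v}"
    using other by (auto simp: nbrs_def)
  ultimately show "card (nbrs E c (1 - c v) v) = deg (edge_class E c 2) v"
    using bij_betw_same_card[OF bij[of "\<lambda>u. c u \<noteq> c v"]] by (simp add: deg_def)
qed

text \<open>Since \<open>c v\<close> is 0 or 1, \<open>1 - c v\<close> always differs from it. Hence
  \<open>c\<close> is fixed exactly when the keeping condition holds at every node.\<close>

lemma fixed_iff:
  assumes "\<forall>e\<in>E. card e = 2" "\<forall>e\<in>E. e \<subseteq> V" and c: "c \<in> colorings V"
  shows "min_proc V E c = c \<longleftrightarrow> (\<forall>v\<in>V. deg (edge_class E c 1) v \<le> deg (edge_class E c 2) v)"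
    and "maj_proc V E c = c \<longleftrightarrow> (\<forall>v\<in>V. deg (edge_class E c 2) v \<le> deg (edge_class E c 1) v)"
proof -
  have ext: "(\<lambda>v\<in>V. if Q v then c v else 1 - c v) = c \<longleftrightarrow> (\<forall>v\<in>V. Q v)" for Q
  proof
    assume eq: "(\<lambda>v\<in>V. if Q v then c v else 1 - c v) = c"
    have "Q v" if "v \<in> V" for v
      using fun_cong[OF eq, of v] coloring_eq_or[OF c that] that by (auto split: if_splits)
    then show "\<forall>v\<in>V. Q v" by blast
  next
    assume "\<forall>v\<in>V. Q v"
    then show "(\<lambda>v\<in>V. if Q v then c v else 1 - c v) = c"
      using c by (auto simp: colorings_def PiE_def extensional_def)
  qed
  show "min_proc V E c = c \<longleftrightarrow> (\<forall>v\<in>V. deg (edge_class E c 1) v \<le> deg (edge_class E c 2) v)"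
    unfolding min_proc_def ext using card_nbrs[OF assms] by simp
  show "maj_proc V E c = c \<longleftrightarrow> (\<forall>v\<in>V. deg (edge_class E c 2) v \<le> deg (edge_class E c 1) v)"
    unfolding maj_proc_def ext using card_nbrs[OF assms] by simp
qed

text \<open>The two classes partition \<open>E\<close>. This turns a comparison of their degrees
  into the bound by half of \<open>deg E v\<close>.\<close>

lemma deg_edge_class_add:
  assumes "finite E" "\<forall>e\<in>E. card e = 2"
  shows "deg E v = deg (edge_class E c 1) v + deg (edge_class E c 2) v"
proof -
  have "card (c ` e) = 1 \<or> card (c ` e) = 2" if "e \<in> E" for e
  proof -
    obtain x y where "e = {x, y}" using assms(2) \<open>e \<in> E\<close> by (meson card_2_iff)
    then show ?thesis using card_image_edge[of c x y] by auto
  qed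
  then have "{e \<in> E. v \<in> e} = {e \<in> edge_class E c 1. v \<in> e} \<union> {e \<in> edge_class E c 2. v \<in> e}"
    by (auto simp: edge_class_def)
  moreover have "card ({e \<in> edge_class E c 1. v \<in> e} \<union> {e \<in> edge_class E c 2. v \<in> e})
      = card {e \<in> edge_class E c 1. v \<in> e} + card {e \<in> edge_class E c 2. v \<in> e}"
    using assms(1) by (intro card_Un_disjoint) (auto simp: edge_class_def)
  ultimately show ?thesis by (simp add: deg_def)
qed

text \<open>An edge of \<open>F\<close> at \<open>v\<close> gives \<open>deg F v \<ge> 1\<close>,
  and the bound then forces \<open>deg E v \<ge> 2\<close>. So \<open>F\<close> lies in
  \<open>E2 E\<close> automatically.\<close>

lemma legal_iff:
  assumes "finite E" "\<forall>e\<in>E. e \<subseteq> V"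
  shows "legal V E F \<longleftrightarrow> F \<subseteq> E \<and> (\<forall>v\<in>V. 2 * deg F v \<le> deg E v)"
proof -
  have "2 \<le> deg E v"
    if "F \<subseteq> E" "\<forall>v\<in>V. 2 * deg F v \<le> deg E v" "e \<in> F" "v \<in> e" for e v
  proof -
    have "finite {e \<in> F. v \<in> e}" using assms(1) that(1) by (auto intro: finite_subset)
    then have "deg F v \<ge> 1"
      using that(3,4) by (auto simp: deg_def Suc_le_eq card_gt_0_iff)
    moreover have "v \<in> V" using that assms(2) by blast
    ultimately show ?thesis using that(2) by force
  qed
  moreover have "real (deg F v) \<le> real (deg E v) / 2 \<longleftrightarrow> 2 * deg F v \<le> deg E v" for v
    by linarith
  ultimately show ?thesis by (auto simp: legal_def E2_def)
qed

theorem theorem3: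
  fixes V :: "'a set" and E :: "'a set set" and vstar :: 'a
    and M :: "('a \<Rightarrow> nat) \<Rightarrow> 'a \<Rightarrow> nat"
  assumes "fin_tree V E"
    and "vstar \<in> V"
    and "M \<in> {min_proc V E, maj_proc V E}"
  shows "\<exists>f. bij_betw f (E_fix V E) (fixed_points_plus V M vstar)"
proof -
  note T = fin_treeD[OF assms(1)]
  \<comment> \<open>The class to be bounded is that of the edges that press a node to change:
    \<open>k = 1\<close> for minority, \<open>k = 2\<close> for majority.\<close>
  have "\<exists>k\<in>{1, 2}. \<forall>c\<in>colorings V. M c = c \<longleftrightarrow> legal V E (edge_class E c k)"
  proof (cases "M = min_proc V E")
    case True
    then have "M c = c \<longleftrightarrow> legal V E (edge_class E c 1)" if "c \<in> colorings V" for c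
      using fixed_iff(1)[OF T(3,4) that] deg_edge_class_add[OF T(2,3), of _ c]
      by (auto simp: legal_iff[OF T(2,4)] edge_class_def)
    then show ?thesis by blast
  next
    case False
    then have "M = maj_proc V E" using assms(3) by blast
    then have "M c = c \<longleftrightarrow> legal V E (edge_class E c 2)" if "c \<in> colorings V" for c
      using fixed_iff(2)[OF T(3,4) that] deg_edge_class_add[OF T(2,3), of _ c]
      by (auto simp: legal_iff[OF T(2,4)] edge_class_def)
    then show ?thesis by blast
  qed
  then obtain k :: nat where k: "k \<in> {1, 2}"
    and fix_iff: "\<And>c. c \<in> colorings V \<Longrightarrow> M c = c \<longleftrightarrow> legal V E (edge_class E c k)"
    by blast
  let ?C = "{c \<in> colorings V. c vstar = 0}" and ?g = "\<lambda>c. edge_class E c k"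
  have bij: "bij_betw ?g ?C (Pow E)"
    by (rule bij_betw_edge_class[OF assms(1,2) k])
  have fp: "fixed_points_plus V M vstar = {c \<in> ?C. legal V E (?g c)}"
    using fix_iff by (auto simp: fixed_points_plus_def fixed_points_def)
  \<comment> \<open>Every legal set is a subset of \<open>E\<close> and so the class of some
    normalized coloring. Hence \<open>?g\<close> restricts to a bijection from fixed points onto
    legal sets, whose inverse is the map sought.\<close>
  have "E_fix V E \<subseteq> ?g ` ?C"
    using bij by (auto simp: E_fix_def bij_betw_def legal_iff[OF T(2,4)])
  then have "?g ` fixed_points_plus V M vstar = E_fix V E"
    unfolding fp by (auto simp: E_fix_def)
  then have "bij_betw ?g (fixed_points_plus V M vstar) (E_fix V E)"
    using bij by (auto intro: bij_betw_subset simp: fp)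
  then show ?thesis using bij_betw_inv by blast
qed

end
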